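(* Let $d \in \{1,2,3,4\}$ and let $P(x) \in \mathbb{R}[x]$ be a polynomial of degree $d$ such that $P(x) > 0$ for every real $x \ge 0$. Set $C_1 = 0$, $C_2 = 1$, $C_3 = \frac{3}{2}$, $C_4 = \frac{4232}{2505}$. Then for every nonnegative integer $m$ with $$m > C_d\,\frac{L(P)}{\lambda(P)} - 1,$$ all the coefficients of $(1+x)^m P(x)$ are positive, i.e. for every integer $k$ with $0 \le k \le m+d$, the coefficient of $x^k$ in $(1+x)^m P(x)$ is strictly positive.
   Context: For a real polynomial $P(x) = \sum_{j=0}^d a_j x^j$ of degree $d$ with $P(x)>0$ for all $x \ge 0$, define $$L(P) := \max_{j=0,\ldots,d} \frac{1}{\binom{d}{j}}|a_j|, \qquad \lambda(P) := \inf_{x \in [0,\infty)} \frac{P(x)}{(1+x)^d}.$$ For such $P$, $\lambda(P)$ is a well-defined positive real number. *)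

theory Defs
  imports Complex_Main "HOL-Computational_Algebra.Polynomial"
begin

definition poly_L :: "real poly \<Rightarrow> real" where
  "poly_L P = (MAX j\<in>{0..degree P}. 1 / real (degree P choose j) * \<bar>coeff P j\<bar>)"

(* The infimum is in the conditionally complete lattice of the reals. It is the true
   infimum whenever the quotient is bounded below on [0, infinity), in particular
   when P is positive there. *)
definition poly_lambda :: "real poly \<Rightarrow> real" where
  "poly_lambda P = (INF x\<in>{0..}. poly P x / (1 + x) ^ degree P)"

definition polya_const :: "nat \<Rightarrow> real" where
  "polya_const d =
     (if d = 1 then 0
      else if d = 2 then 1
      else if d = 3 then 3 / 2
      else if d = 4 then 4232 / 2505
      else undefined)"

end

theory Submission
  imports Defs
begin

text \<open>
  Put \<open>i = m + d - k\<close>. Up to the factor \<open>m! / (k! i!)\<close>, the coefficient of \<open>x\<^sup>k\<close> is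
  \<open>\<Sum>j\<le>d. a\<^sub>j W\<^sub>j\<close>, where \<open>W\<^sub>j\<close> is the product of the falling factorials of \<open>k\<close> of length \<open>j\<close> and of
  \<open>i\<close> of length \<open>d - j\<close>. Replacing \<open>W\<^sub>j\<close> by \<open>(k - c)\<^sup>j (i - a)\<^bsup>d - j\<^esup>\<close> gives a value of the form
  associated with \<open>P\<close>, which is at least \<open>\<lambda> (k + i - a - c)\<^sup>d\<close>; the error is at most \<open>L\<close> times the
  \<open>l\<^sup>1\<close>-norm of the binomially weighted differences. By symmetry \<open>k \<le> i\<close>. For \<open>d = 3\<close> the shift
  \<open>(a, c) = (1, 0)\<close> suffices. For \<open>d = 4\<close> the shift has to depend on \<open>k / (k + i)\<close>: the values
  \<open>(11/8, 1/8)\<close>, \<open>(5/6, 1/3)\<close>, \<open>(2/3, 2/3)\<close> on \<open>[0, 3/10]\<close>, \<open>[3/10, 2/5]\<close>, \<open>[2/5, 1/2]\<close> give the constant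
  \<open>27/16 < 4232/2505\<close>.
\<close>

section \<open>Coefficients of the product in terms of falling factorials\<close>

lemma falling_fact_eq:
  "(\<Prod>l<j. real k - real l) = (if j \<le> k then fact k / fact (k - j) else 0)"
proof (induction j)
  case (Suc j)
  show ?case
  proof (cases "Suc j \<le> k")
    case True
    then have "k - j = Suc (k - Suc j)" by simp
    then have "(fact (k - j) :: real) = (real k - real j) * fact (k - Suc j)"
      using True by (simp add: of_nat_diff)
    moreover have "real k - real j \<noteq> 0" using True by simp
    ultimately show ?thesis using True Suc.IH by (simp add: nonzero_divide_mult_cancel_left)
  next
    case False
    then show ?thesis using Suc.IH by (cases "j = k") auto
  qed
qed simp

text \<open>Since \<open>m - (k - j) = i - (d - j)\<close>, the binomial is \<open>m!\<close> over
  \<open>(k - j)!\<close> and \<open>(i - (d - j))!\<close>. If \<open>j > k\<close> or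
  \<open>d - j > i\<close>, both sides vanish. The guard \<open>j \<le> k\<close> is essential,
  since truncated subtraction would turn the binomial into 1.\<close>

lemma binomial_falling_fact:
  assumes "k + i = m + d" "j \<le> d"
  shows "(if j \<le> k then real (m choose (k - j)) else 0) * fact k * fact i
    = fact m * ((\<Prod>l<j. real k - real l) * (\<Prod>l<d - j. real i - real l))"
proof (cases "j \<le> k \<and> d - j \<le> i")
  case True
  then have "m - (k - j) = i - (d - j)" "k - j \<le> m" using assms by auto
  then show ?thesis using True by (simp add: falling_fact_eq binomial_fact)
next
  case False
  then have "m < k - j" if "j \<le> k" using assms that by auto
  then show ?thesis using False by (auto simp: falling_fact_eq binomial_eq_0)
qed

lemma coeff_linear_power_mult:
  fixes P :: "real poly"
  assumes "degree P = d" "k + i = m + d"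
  shows "coeff ([:1, 1:] ^ m * P) k * fact k * fact i
    = fact m * (\<Sum>j\<le>d. coeff P j * ((\<Prod>l<j. real k - real l) * (\<Prod>l<d - j. real i - real l)))"
proof -
  have "degree ([:1, 1:] ^ m :: real poly) \<le> m"
    using degree_power_le[of "[:1, 1 :: real:]" m] by simp
  then have "coeff ([:1, 1:] ^ m) n = real (m choose n)" for n
    by (cases "n \<le> m") (auto simp: coeff_linear_poly_power coeff_eq_0 binomial_eq_0)
  then have "coeff ([:1, 1:] ^ m * P) k = (\<Sum>j\<le>k. coeff P j * real (m choose (k - j)))"
    by (subst mult.commute) (simp add: coeff_mult)
  also have "\<dots> = (\<Sum>j\<le>d. coeff P j * (if j \<le> k then real (m choose (k - j)) else 0))"
    \<comment> \<open>Terms outside the common range vanish: for \<open>j > d\<close> by the degree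
      of \<open>P\<close>, for \<open>j > k\<close> by the guard.\<close>
    using assms(1) by (intro sum.mono_neutral_cong) (auto simp: coeff_eq_0)
  finally have "coeff ([:1, 1:] ^ m * P) k * fact k * fact i
    = (\<Sum>j\<le>d. coeff P j * ((if j \<le> k then real (m choose (k - j)) else 0) * fact k * fact i))"
    by (simp only: sum_distrib_right mult.assoc)
  also have "\<dots> = (\<Sum>j\<le>d. coeff P j *
      (fact m * ((\<Prod>l<j. real k - real l) * (\<Prod>l<d - j. real i - real l))))"
    by (intro sum.cong refl) (simp only: atMost_iff binomial_falling_fact[OF assms(2)])
  finally show ?thesis by (simp only: sum_distrib_left mult.left_commute)
qed

section \<open>Positivity of the infimum and the homogeneous lower bound\<close>

lemma lead_coeff_pos:
  fixes P :: "real poly"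
  assumes "\<And>x. x \<ge> 0 \<Longrightarrow> poly P x > 0"
  shows "lead_coeff P > 0"
proof (rule ccontr)
  assume "\<not> lead_coeff P > 0"
  moreover have "P \<noteq> 0" using assms[of 0] by auto
  ultimately have "lead_coeff (- P) > 0" by (simp add: less_le)
  then obtain n where "\<And>x. x \<ge> n \<Longrightarrow> poly (- P) x \<ge> lead_coeff (- P)"
    using poly_pinfty_gt_lc by blast
  then have "poly (- P) (max n 0) > 0" using \<open>lead_coeff (- P) > 0\<close>
    by (meson less_le_trans max.cobounded1)
  with assms[of "max n 0"] show False by simp
qed

lemma poly_homogeneous:
  fixes P :: "real poly"
  assumes "degree P = d" "y \<noteq> 0"
  shows "(\<Sum>j\<le>d. coeff P j * x ^ j * y ^ (d - j)) = y ^ d * poly P (x / y)"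
proof -
  have "x ^ j * y ^ (d - j) = y ^ d * (x / y) ^ j" if "j \<le> d" for j
    using that assms(2) by (simp add: power_divide power_diff)
  then show ?thesis
    using assms(1) by (auto simp: poly_altdef sum_distrib_left intro!: sum.cong)
qed

text \<open>The substitution \<open>t = x / (1 + x)\<close> maps \<open>[0, \<infinity>)\<close>
  onto \<open>[0, 1)\<close> and turns the quotient into \<open>G\<close>, the homogenization of
  \<open>P\<close> on the segment of points \<open>(t, 1 - t)\<close>. The added point
  \<open>t = 1\<close> gives the leading coefficient, so compactness yields a positive minimum. The
  second claim is the bound at \<open>x / y\<close>, scaled by \<open>y ^ d\<close>.\<close>

lemma poly_lambda_props:
  fixes P :: "real poly"
  assumes pos: "\<And>x. x \<ge> 0 \<Longrightarrow> poly P x > 0" and d: "degree P = d"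
  shows "poly_lambda P > 0"
    and "\<And>x y. x \<ge> 0 \<Longrightarrow> y > 0 \<Longrightarrow>
      poly_lambda P * (x + y) ^ d \<le> (\<Sum>j\<le>d. coeff P j * x ^ j * y ^ (d - j))"
proof -
  define G where "G t = (\<Sum>j\<le>d. coeff P j * t ^ j * (1 - t) ^ (d - j))" for t
  have Gpos: "G t > 0" if "t \<in> {0..1}" for t
  proof (cases "t = 1")
    case True
    have "G 1 = (\<Sum>j\<in>{d}. coeff P j * 1 ^ j * (1 - 1) ^ (d - j))"
      unfolding G_def by (rule sum.mono_neutral_right) auto
    then show ?thesis using True lead_coeff_pos[OF pos] d by simp
  next
    case False
    with that have "0 < 1 - t" "0 \<le> t" by auto
    then show ?thesis
      using poly_homogeneous[OF d, of "1 - t" t] pos[of "t / (1 - t)"] by (simp add: G_def)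
  qed
  have "continuous_on {0..1} G" unfolding G_def by (intro continuous_intros)
  then obtain t0 where t0: "t0 \<in> {0..1}" "\<And>t. t \<in> {0..1} \<Longrightarrow> G t0 \<le> G t"
    using continuous_attains_inf[of "{0..1::real}" G] by auto
  have GP: "poly P x / (1 + x) ^ d = G (x / (1 + x))" if "x \<ge> 0" for x
  proof -
    have "1 - x / (1 + x) = 1 / (1 + x)" "(x / (1 + x)) / (1 / (1 + x)) = x"
      using that by (simp_all add: field_simps)
    then show ?thesis using poly_homogeneous[OF d, of "1 / (1 + x)" "x / (1 + x)"] that
      by (simp add: G_def power_divide)
  qed
  have bound: "G t0 \<le> poly P x / (1 + x) ^ d" if "x \<ge> 0" for x
    using t0(2)[of "x / (1 + x)"] GP[OF that] that by simp
  have "G t0 \<le> poly_lambda P"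
    unfolding poly_lambda_def d by (rule cINF_greatest) (use bound in auto)
  with Gpos[OF t0(1)] show "poly_lambda P > 0" by linarith
  have le: "poly_lambda P \<le> poly P x / (1 + x) ^ d" if "x \<ge> 0" for x
    unfolding poly_lambda_def d
    by (rule cINF_lower) (use bound that in \<open>auto intro!: bdd_belowI2[of _ "G t0"]\<close>)
  show "poly_lambda P * (x + y) ^ d \<le> (\<Sum>j\<le>d. coeff P j * x ^ j * y ^ (d - j))"
    if "x \<ge> 0" "y > 0" for x y
  proof -
    have "x + y = y * (1 + x / y)" using that by (simp add: field_simps)
    then have "poly_lambda P * (x + y) ^ d = y ^ d * (poly_lambda P * (1 + x / y) ^ d)"
      by (simp add: power_mult_distrib)
    also have "\<dots> \<le> y ^ d * poly P (x / y)"
      using le[of "x / y"] that by (intro mult_left_mono) (simp_all add: pos_le_divide_eq add_pos_nonneg)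
    finally show ?thesis using poly_homogeneous[OF d, of y x] that by simp
  qed
qed

section \<open>Forms of degree two and three\<close>

lemma coeff_le_poly_L:
  assumes "j \<le> degree P"
  shows "\<bar>coeff P j / real (degree P choose j)\<bar> \<le> poly_L P"
  using assms unfolding poly_L_def by (intro Max_ge) (auto intro!: image_eqI[of _ _ j] simp: abs_divide)

lemma quadratic_form_pos:
  fixes b0 b1 b2 L lam i k :: real
  assumes pos: "lam * (k + i)\<^sup>2 \<le> b0 * i\<^sup>2 + 2 * b1 * k * i + b2 * k\<^sup>2"
    and "\<bar>b0\<bar> \<le> L" "\<bar>b2\<bar> \<le> L" "0 \<le> k" "0 < i" "L < lam * (k + i)"
  shows "0 < b0 * (i * (i - 1)) + 2 * b1 * (k * i) + b2 * (k * (k - 1))"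
proof -
  have "b0 * i \<le> L * i" "b2 * k \<le> L * k" using assms by (auto intro!: mult_right_mono)
  then have "b0 * i + b2 * k \<le> L * (k + i)" by (simp add: algebra_simps)
  also have "\<dots> < lam * (k + i) * (k + i)" using assms by (intro mult_strict_right_mono) auto
  finally show ?thesis using pos by (simp add: algebra_simps power2_eq_square)
qed

text \<open>Evaluating the form at the point \<open>(k, i - 1)\<close> instead of \<open>(k, i)\<close> lowers the constant
  from \<open>3\<close> to \<open>3/2\<close>.\<close>
lemma cubic_form_pos:
  fixes b0 b1 b2 b3 L lam i k :: real
  assumes pos: "lam * (k + (i - 1)) ^ 3 \<le>
      b0 * (i - 1) ^ 3 + 3 * b1 * k * (i - 1)\<^sup>2 + 3 * b2 * k\<^sup>2 * (i - 1) + b3 * k ^ 3"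
    and L: "\<bar>b0\<bar> \<le> L" "\<bar>b1\<bar> \<le> L" "\<bar>b2\<bar> \<le> L" "\<bar>b3\<bar> \<le> L"
    and k: "1 \<le> k" "k \<le> i" and i: "1 < i" and lam: "3 / 2 * L < lam * (k + i - 2)"
  shows "0 < b0 * (i * (i - 1) * (i - 2)) + 3 * b1 * (k * (i * (i - 1)))
    + 3 * b2 * (k * (k - 1) * i) + b3 * (k * (k - 1) * (k - 2))"
proof -
  \<comment> \<open>These are the absolute values of the weighted differences; only the one for
    index 1 enters with a minus sign. \<open>k \<le> i\<close> is what makes \<open>e2\<close>
    nonnegative.\<close>
  define e0 e1 e2 e3 u where "e0 = i - 1" "e1 = 3 * k * (i - 1)" "e2 = 3 * k * (i - k)" "e3 = 3 * k\<^sup>2 - 2 * k"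
    "u = k + i - 1"
  note e = this
  have "0 \<le> e0" "0 \<le> e1" "0 \<le> e2" using k i by (auto simp: e)
  moreover have "0 \<le> e3" using k by (auto simp: e power2_eq_square intro!: mult_nonneg_nonneg)
  ultimately have "b0 * e0 \<le> L * e0" "- b1 * e1 \<le> L * e1" "b2 * e2 \<le> L * e2" "b3 * e3 \<le> L * e3"
    using L by (auto intro!: mult_right_mono simp del: mult_minus_left)
  then have err: "b0 * e0 - b1 * e1 + b2 * e2 + b3 * e3 \<le> L * (e0 + e1 + e2 + e3)"
    by (simp add: algebra_simps)
  have u: "1 < u" "0 \<le> L" using k i L by (auto simp: e)
  \<comment> \<open>The sum of the errors is \<open>6 * k * (i - 1) + u\<close>, and
    \<open>4 * k * (i - 1) \<le> u^2\<close> produces the constant 3/2.\<close>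
  have "0 \<le> (i - 1 - k)\<^sup>2" by simp
  then have "e0 + e1 + e2 + e3 \<le> 3 / 2 * u\<^sup>2 + u"
    by (simp add: e power2_eq_square algebra_simps)
  \<comment> \<open>The factor \<open>u - 1 = k + i - 2\<close> is the one in the hypothesis on
    \<open>lam\<close>; after multiplication the linear summand \<open>u\<close> is
    absorbed.\<close>
  then have "L * (e0 + e1 + e2 + e3) * (u - 1) \<le> L * (3 / 2 * u\<^sup>2 + u) * (u - 1)"
    using u by (intro mult_right_mono mult_left_mono) auto
  also have "\<dots> = 3 / 2 * L * u ^ 3 - L * (u\<^sup>2 / 2 + u)"
    by (simp add: field_simps power2_eq_square power3_eq_cube)
  also have "\<dots> \<le> 3 / 2 * L * u ^ 3" using u by simp
  also have "\<dots> < lam * (u - 1) * u ^ 3"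
    using lam u by (intro mult_strict_right_mono) (auto simp: e algebra_simps)
  finally have "L * (e0 + e1 + e2 + e3) < lam * u ^ 3" using u by (simp add: mult.commute mult.left_commute)
  moreover have "b0 * (i * (i - 1) * (i - 2)) + 3 * b1 * (k * (i * (i - 1)))
      + 3 * b2 * (k * (k - 1) * i) + b3 * (k * (k - 1) * (k - 2))
    = b0 * (i - 1) ^ 3 + 3 * b1 * k * (i - 1)\<^sup>2 + 3 * b2 * k\<^sup>2 * (i - 1) + b3 * k ^ 3
      - (b0 * e0 - b1 * e1 + b2 * e2 + b3 * e3)"
    by (simp add: e power2_eq_square power3_eq_cube algebra_simps)
  ultimately show ?thesis using pos err by (simp add: e algebra_simps)
qed

section \<open>Nonnegativity certificates for cubics in two variables\<close>

text \<open>The two digits of a coefficient are the exponents of \<open>N\<close> and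
  \<open>k\<close>; the total degree is at most three.\<close>

definition bicubic ::
  "real \<Rightarrow> real \<Rightarrow> real \<Rightarrow> real \<Rightarrow> real \<Rightarrow> real \<Rightarrow> real \<Rightarrow> real \<Rightarrow> real \<Rightarrow> real \<Rightarrow> real \<Rightarrow> real \<Rightarrow> real"
  where "bicubic a00 a10 a20 a30 a01 a11 a21 a02 a12 a03 N k =
    a00 + a10 * N + a20 * N\<^sup>2 + a30 * N ^ 3 + (a01 + a11 * N + a21 * N\<^sup>2) * k
    + (a02 + a12 * N) * k\<^sup>2 + a03 * k ^ 3"

text \<open>The Bernstein coefficients of \<open>bicubic\<close> on the interval \<open>[p N, q N]\<close> for \<open>k\<close> are the values of its polar
  form at \<open>(u N, v N, w N)\<close> with \<open>u, v, w \<in> {p, q}\<close>. Such a value is the cubic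
  \<open>b0 + b1 N + b2 N\<^sup>2 + b3 N\<^sup>3\<close>, and the conditions say that its Taylor coefficients at \<open>N = 5\<close> are
  nonnegative.\<close>
definition blossom_nonneg ::
  "real \<Rightarrow> real \<Rightarrow> real \<Rightarrow> real \<Rightarrow> real \<Rightarrow> real \<Rightarrow> real \<Rightarrow> real \<Rightarrow> real \<Rightarrow> real \<Rightarrow> real \<Rightarrow> real \<Rightarrow> real \<Rightarrow> bool"
  where "blossom_nonneg a00 a10 a20 a30 a01 a11 a21 a02 a12 a03 u v w \<longleftrightarrow>
    (let s1 = (u + v + w) / 3; s2 = (u * v + u * w + v * w) / 3;
       b0 = a00; b1 = a10 + a01 * s1; b2 = a20 + a11 * s1 + a02 * s2;
       b3 = a30 + a21 * s1 + a12 * s2 + a03 * (u * v * w)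
     in 0 \<le> b3 \<and> 0 \<le> b2 + 15 * b3 \<and> 0 \<le> b1 + 10 * b2 + 75 * b3
       \<and> 0 \<le> b0 + 5 * b1 + 25 * b2 + 125 * b3)"

lemma cubic_nonneg_beyond_5:
  fixes N :: real
  assumes "5 \<le> N" "0 \<le> b3" "0 \<le> b2 + 15 * b3" "0 \<le> b1 + 10 * b2 + 75 * b3"
    "0 \<le> b0 + 5 * b1 + 25 * b2 + 125 * b3"
  shows "0 \<le> b0 + b1 * N + b2 * N\<^sup>2 + b3 * N ^ 3"
proof -
  define M where "M = N - 5"
  have "0 \<le> c0 + c1 * M + c2 * M\<^sup>2 + c3 * M ^ 3" if "0 \<le> c0" "0 \<le> c1" "0 \<le> c2" "0 \<le> c3"
    for c0 c1 c2 c3 using that assms(1) by (simp add: M_def)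
  from this[OF assms(5,4,3,2)]
  have "0 \<le> (b0 + 5 * b1 + 25 * b2 + 125 * b3) + (b1 + 10 * b2 + 75 * b3) * M
      + (b2 + 15 * b3) * M\<^sup>2 + b3 * M ^ 3" .
  also have "\<dots> = b0 + b1 * N + b2 * N\<^sup>2 + b3 * N ^ 3"
    by (simp add: M_def power2_eq_square power3_eq_cube algebra_simps)
  finally show ?thesis .
qed

text \<open>For fixed \<open>N\<close> the value is a convex combination of the four Bernstein
  coefficients on \<open>[p N, q N]\<close>, and each certificate makes one of them nonnegative for
  all \<open>N \<ge> 5\<close>.\<close>

lemma bicubic_nonneg:
  fixes N k p q :: real
  assumes N: "5 \<le> N" and k: "p * N \<le> k" "k \<le> q * N" and pq: "p < q"
    and cert: "blossom_nonneg a00 a10 a20 a30 a01 a11 a21 a02 a12 a03 p p p"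
      "blossom_nonneg a00 a10 a20 a30 a01 a11 a21 a02 a12 a03 p p q"
      "blossom_nonneg a00 a10 a20 a30 a01 a11 a21 a02 a12 a03 p q q"
      "blossom_nonneg a00 a10 a20 a30 a01 a11 a21 a02 a12 a03 q q q"
  shows "0 \<le> bicubic a00 a10 a20 a30 a01 a11 a21 a02 a12 a03 N k"
proof -
  define B where "B u v w =
      a00 + (a10 + a01 * ((u + v + w) / 3)) * N
      + (a20 + a11 * ((u + v + w) / 3) + a02 * ((u * v + u * w + v * w) / 3)) * N\<^sup>2
      + (a30 + a21 * ((u + v + w) / 3) + a12 * ((u * v + u * w + v * w) / 3) + a03 * (u * v * w)) * N ^ 3"
    for u v w
  have B: "0 \<le> B u v w" if "blossom_nonneg a00 a10 a20 a30 a01 a11 a21 a02 a12 a03 u v w" for u v w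
    unfolding B_def using that N
    by (intro cubic_nonneg_beyond_5) (simp_all add: blossom_nonneg_def Let_def)
  define t where "t = (k - p * N) / ((q - p) * N)"
  have t: "0 \<le> t" "t \<le> 1" "k = (p + (q - p) * t) * N"
    using N k pq by (simp_all add: t_def field_simps)
  have "0 \<le> B p p p * (1 - t) ^ 3 + 3 * (B p p q * (t * (1 - t)\<^sup>2)) + 3 * (B p q q * (t\<^sup>2 * (1 - t)))
      + B q q q * t ^ 3"
    using B cert t by simp
  also have "\<dots> = bicubic a00 a10 a20 a30 a01 a11 a21 a02 a12 a03 N k"
    unfolding B_def bicubic_def t(3) by (simp add: field_simps power2_eq_square power3_eq_cube)
  finally show ?thesis .
qed

section \<open>Degree four: signs and sizes of the errors\<close>

text \<open>With \<open>z = n - 3 / 2\<close> the left side is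
  \<open>(z^2 - 1/4) * (z^2 - 9/4)\<close>, which is at most \<open>z^4\<close> once
  \<open>z^2 \<ge> 1/4\<close>. For \<open>n = 1\<close> it is zero.\<close>

lemma falling_fact4_le:
  fixes c :: real and n :: nat
  assumes "1 \<le> n" "c \<le> 3 / 2"
  shows "real n * (real n - 1) * (real n - 2) * (real n - 3) \<le> (real n - c) ^ 4"
proof (cases "n = 1")
  case False
  with assms have n: "2 \<le> real n" by auto
  then have "(1 / 2)\<^sup>2 \<le> (real n - 3 / 2)\<^sup>2" by (intro power_mono) auto
  then have "real n * (real n - 1) * (real n - 2) * (real n - 3) \<le> (real n - 3 / 2) ^ 4"
    by (simp add: power4_eq_xxxx power2_eq_square field_simps)
  also have "\<dots> \<le> (real n - c) ^ 4" using n assms by (intro power_mono) auto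
  finally show ?thesis .
qed simp

text \<open>With \<open>p = k - 1\<close> and \<open>g = 1 - c\<close>, the cubic falling factorial
  is \<open>p^3 - p\<close>, while \<open>(p + g)^3 \<ge> p^3 + 3 * p^2 * g\<close>. The last
  hypothesis compares \<open>p^3 * i\<close> with this lower bound times
  \<open>i - a\<close>.\<close>

lemma falling_fact3_le:
  fixes c a i k :: real
  assumes "1 \<le> k" "c \<le> 1" "0 \<le> i" "a \<le> i" "a * (k - 1) \<le> 3 * (1 - c) * (i - a)"
  shows "k * (k - 1) * (k - 2) * i \<le> (k - c) ^ 3 * (i - a)"
proof -
  define p g where "p = k - 1" "g = 1 - c"
  note pg = this
  have pos: "0 \<le> p" "0 \<le> g" "0 \<le> i - a" "a * p \<le> 3 * g * (i - a)"
    using assms by (auto simp: pg)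
  have "p * i \<le> 3 * g * (i - a) + p * (i - a)" using pos by (simp add: algebra_simps)
  then have "p\<^sup>2 * (p * i) \<le> p\<^sup>2 * (3 * g * (i - a) + p * (i - a))"
    by (intro mult_left_mono) auto
  moreover have "0 \<le> (3 * p * g\<^sup>2 + g ^ 3) * (i - a)" using pos by simp
  ultimately have "p ^ 3 * i \<le> (p + g) ^ 3 * (i - a)"
    by (simp add: power2_eq_square power3_eq_cube algebra_simps)
  moreover have "k * (k - 1) * (k - 2) * i = p ^ 3 * i - p * i"
    by (simp add: pg power3_eq_cube algebra_simps)
  moreover have "0 \<le> p * i" using pos assms by simp
  ultimately show ?thesis by (simp add: pg)
qed

definition err1 :: "real \<Rightarrow> real \<Rightarrow> real \<Rightarrow> real \<Rightarrow> real" where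
  "err1 a c k i = 4 * (k * (i * (i - 1) * (i - 2)) - (k - c) * (i - a) ^ 3)"

definition err2 :: "real \<Rightarrow> real \<Rightarrow> real \<Rightarrow> real \<Rightarrow> real" where
  "err2 a c k i = 6 * (k * (k - 1) * (i * (i - 1)) - (k - c)\<^sup>2 * (i - a)\<^sup>2)"

definition slack :: "real \<Rightarrow> real \<Rightarrow> real \<Rightarrow> real \<Rightarrow> real" where
  "slack a c k i = 27 / 16 * (k + i - a - c)\<^sup>2 * (k + i - 2 * a - 2 * c + 3)
     + (k + i) * (k + i - 1) * (k + i - 2) * (k + i - 3) - (k + i - a - c) ^ 4"

text \<open>For the shifts in use, the differences for the indices \<open>0, 3, 4\<close> are nonpositive. Hence the \<open>l\<^sup>1\<close>-norm of all five
  is twice the sum of the positive parts of \<open>err1\<close> and \<open>err2\<close> minus their total, which is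
  added to the first summand of \<open>slack\<close>. This summand \<open>27/16 n\<^sup>2 (n + t)\<close>, with
  \<open>n = k + i - a - c\<close> and \<open>t = 3 - a - c\<close>, replaces the larger \<open>27/16 n\<^sup>4 / (n - t)\<close> to keep the
  bounds cubic.\<close>
definition error_bound :: "real \<Rightarrow> real \<Rightarrow> real \<Rightarrow> real \<Rightarrow> bool" where
  "error_bound a c k i \<longleftrightarrow> 2 * max 0 (err1 a c k i) + 2 * max 0 (err2 a c k i) \<le> slack a c k i"

lemmas error_simps = err1_def err2_def slack_def bicubic_def
  power2_eq_square power3_eq_cube power4_eq_xxxx field_simps

text \<open>For \<open>k = r N\<close> the leading part of \<open>2 * err1\<close> is
  \<open>(1 - r)^2 * (1 + 8 * r) * N^3\<close>. Its maximum on \<open>[0, 1]\<close>, at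
  \<open>r = 1/4\<close>, is the source of 27/16. The leading part of \<open>err2\<close> changes
  sign from negative to positive at \<open>r = 3/10\<close>, which ends the range.\<close>

lemma error_bound_outer:
  fixes i k :: real
  assumes "5 \<le> k + i" "0 \<le> k" "k \<le> 3 / 10 * (k + i)"
  shows "error_bound (11 / 8) (1 / 8) k i"
proof -
  define N where "N = k + i"
  have i: "i = N - k" and N: "5 \<le> N" "0 \<le> k" "k \<le> 3 / 10 * N" using assms by (auto simp: N_def)
  have "slack (11 / 8) (1 / 8) k i
      = bicubic (- 81 / 16) (723 / 64) (- 121 / 16) (27 / 16) 0 0 0 0 0 0 N k"
    unfolding i by (simp add: error_simps)
  also have "0 \<le> \<dots>"
    by (rule bicubic_nonneg[of N 0 k "3 / 10"]) (use N in \<open>simp_all add: blossom_nonneg_def\<close>)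
  finally have f0: "0 \<le> slack (11 / 8) (1 / 8) k i" .
  have "slack (11 / 8) (1 / 8) k i - 2 * err1 (11 / 8) (1 / 8) k i
      = bicubic (- 1261 / 512) (45 / 8) (- 55 / 16) (11 / 16) (- 121 / 8) (169 / 8) (- 6) (- 101 / 4) 15 (- 8) N k"
    unfolding i by (simp add: error_simps)
  also have "0 \<le> \<dots>"
  proof -
    \<comment> \<open>The leading part has a double zero at \<open>k = N / 4\<close>. Nonnegative
      Bernstein coefficients with an interior zero would all vanish, so 1/4 must be an end
      point.\<close>
    consider "0 \<le> k" "k \<le> 1 / 5 * N"
      | "1 / 5 * N \<le> k" "k \<le> 1 / 4 * N"
      | "1 / 4 * N \<le> k" "k \<le> 3 / 10 * N"
      using N by linarith
    then show ?thesis
    proof cases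
      case 1
      then show ?thesis
        by (intro bicubic_nonneg[of N 0 k "1 / 5"]) (use N in \<open>simp_all add: blossom_nonneg_def\<close>)
    next
      case 2
      then show ?thesis
        by (intro bicubic_nonneg[of N "1 / 5" k "1 / 4"]) (use N in \<open>simp_all add: blossom_nonneg_def\<close>)
    next
      case 3
      then show ?thesis
        by (intro bicubic_nonneg[of N "1 / 4" k "3 / 10"]) (use N in \<open>simp_all add: blossom_nonneg_def\<close>)
    qed
  qed
  finally have f1: "0 \<le> slack (11 / 8) (1 / 8) k i - 2 * err1 (11 / 8) (1 / 8) k i" .
  have "- err2 (11 / 8) (1 / 8) k i
      = bicubic (363 / 2048) (- 33 / 128) (3 / 32) 0 (- 165 / 64) (- 33 / 16) (9 / 2) (213 / 16) (- 39 / 2) 15 N k"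
    unfolding i by (simp add: error_simps)
  also have "0 \<le> \<dots>"
  proof -
    consider "0 \<le> k" "k \<le> 1 / 5 * N"
      | "1 / 5 * N \<le> k" "k \<le> 3 / 10 * N"
      using N by linarith
    then show ?thesis
    proof cases
      case 1
      then show ?thesis
        by (intro bicubic_nonneg[of N 0 k "1 / 5"]) (use N in \<open>simp_all add: blossom_nonneg_def\<close>)
    next
      case 2
      then show ?thesis
        by (intro bicubic_nonneg[of N "1 / 5" k "3 / 10"]) (use N in \<open>simp_all add: blossom_nonneg_def\<close>)
    qed
  qed
  finally have e2: "0 \<le> - err2 (11 / 8) (1 / 8) k i" .
  show ?thesis using f0 f1 e2 unfolding error_bound_def by linarith
qed

text \<open>The leading part of \<open>err2\<close> changes sign at \<open>k = N / 3\<close>, inside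
  the range, so all four choices in the two maxima are checked.\<close>

lemma error_bound_middle:
  fixes i k :: real
  assumes "5 \<le> k + i" "3 / 10 * (k + i) \<le> k" "k \<le> 2 / 5 * (k + i)"
  shows "error_bound (5 / 6) (1 / 3) k i"
proof -
  define N where "N = k + i"
  have i: "i = N - k" and N: "5 \<le> N" "3 / 10 * N \<le> k" "k \<le> 2 / 5 * N" using assms by (auto simp: N_def)
  have "slack (5 / 6) (1 / 3) k i
      = bicubic (- 833 / 2592) (41 / 1728) (1 / 48) (17 / 48) 0 0 0 0 0 0 N k"
    unfolding i by (simp add: error_simps)
  also have "0 \<le> \<dots>"
    by (rule bicubic_nonneg[of N "3 / 10" k "2 / 5"]) (use N in \<open>simp_all add: blossom_nonneg_def\<close>)
  finally have f0: "0 \<le> slack (5 / 6) (1 / 3) k i" .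
  have "slack (5 / 6) (1 / 3) k i - 2 * err1 (5 / 6) (1 / 3) k i
      = bicubic (3167 / 2592) (- 9559 / 1728) (107 / 16) (- 37 / 16) (25 / 27) (- 38 / 3) 12 6 (- 16) (20 / 3) N k"
    unfolding i by (simp add: error_simps)
  also have "0 \<le> \<dots>"
    by (rule bicubic_nonneg[of N "3 / 10" k "2 / 5"]) (use N in \<open>simp_all add: blossom_nonneg_def\<close>)
  finally have f1: "0 \<le> slack (5 / 6) (1 / 3) k i - 2 * err1 (5 / 6) (1 / 3) k i" .
  have "slack (5 / 6) (1 / 3) k i - 2 * err2 (5 / 6) (1 / 3) k i
      = bicubic (1567 / 2592) (- 3799 / 1728) (65 / 48) (17 / 48) (- 10 / 3) (- 4 / 3) 4 (25 / 3) (- 16) 12 N k"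
    unfolding i by (simp add: error_simps)
  also have "0 \<le> \<dots>"
    by (rule bicubic_nonneg[of N "3 / 10" k "2 / 5"]) (use N in \<open>simp_all add: blossom_nonneg_def\<close>)
  finally have f2: "0 \<le> slack (5 / 6) (1 / 3) k i - 2 * err2 (5 / 6) (1 / 3) k i" .
  have "slack (5 / 6) (1 / 3) k i - 2 * err1 (5 / 6) (1 / 3) k i - 2 * err2 (5 / 6) (1 / 3) k i
      = bicubic (5567 / 2592) (- 13399 / 1728) (385 / 48) (- 37 / 16) (- 65 / 27) (- 14) 16 (43 / 3) (- 32) (56 / 3) N k"
    unfolding i by (simp add: error_simps)
  also have "0 \<le> \<dots>"
    by (rule bicubic_nonneg[of N "3 / 10" k "2 / 5"]) (use N in \<open>simp_all add: blossom_nonneg_def\<close>)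
  finally have f12: "0 \<le> slack (5 / 6) (1 / 3) k i - 2 * err1 (5 / 6) (1 / 3) k i - 2 * err2 (5 / 6) (1 / 3) k i" .
  show ?thesis using f0 f1 f2 f12 unfolding error_bound_def by linarith
qed

text \<open>The leading part of \<open>err1\<close> is a positive multiple of
  \<open>(1 - r)^2 * (2 - 5 * r)\<close> for \<open>k = r N\<close>, so from \<open>r = 2/5\<close>
  on \<open>err1\<close> drops out.\<close>

lemma error_bound_inner:
  fixes i k :: real
  assumes "5 \<le> k + i" "2 / 5 * (k + i) \<le> k" "k \<le> 1 / 2 * (k + i)"
  shows "error_bound (2 / 3) (2 / 3) k i"
proof -
  define N where "N = k + i"
  have i: "i = N - k" and N: "5 \<le> N" "2 / 5 * N \<le> k" "k \<le> 1 / 2 * N" using assms by (auto simp: N_def)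
  have "slack (2 / 3) (2 / 3) k i
      = bicubic (- 175 / 81) (269 / 54) (- 173 / 48) (49 / 48) 0 0 0 0 0 0 N k"
    unfolding i by (simp add: error_simps)
  also have "0 \<le> \<dots>"
    by (rule bicubic_nonneg[of N "2 / 5" k "1 / 2"]) (use N in \<open>simp_all add: blossom_nonneg_def\<close>)
  finally have f0: "0 \<le> slack (2 / 3) (2 / 3) k i" .
  have "slack (2 / 3) (2 / 3) k i - 2 * err2 (2 / 3) (2 / 3) k i
      = bicubic (17 / 81) (- 115 / 54) (83 / 48) (49 / 48) 0 (- 4 / 3) (- 4) (4 / 3) 4 0 N k"
    unfolding i by (simp add: error_simps)
  also have "0 \<le> \<dots>"
    by (rule bicubic_nonneg[of N "2 / 5" k "1 / 2"]) (use N in \<open>simp_all add: blossom_nonneg_def\<close>)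
  finally have f2: "0 \<le> slack (2 / 3) (2 / 3) k i - 2 * err2 (2 / 3) (2 / 3) k i" .
  have "- err1 (2 / 3) (2 / 3) k i
      = bicubic (64 / 81) (- 32 / 9) (16 / 3) (- 8 / 3) (64 / 27) (- 40 / 3) 12 8 (- 16) (20 / 3) N k"
    unfolding i by (simp add: error_simps)
  also have "0 \<le> \<dots>"
    by (rule bicubic_nonneg[of N "2 / 5" k "1 / 2"]) (use N in \<open>simp_all add: blossom_nonneg_def\<close>)
  finally have e1: "0 \<le> - err1 (2 / 3) (2 / 3) k i" .
  show ?thesis using f0 f2 e1 unfolding error_bound_def by linarith
qed

section \<open>Positivity of the quartic form\<close>

lemma quartic_form_pos_if_error_bound:
  fixes b0 b1 b2 b3 b4 L lam a c :: real and i k :: nat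
  defines "x \<equiv> real k - c" and "y \<equiv> real i - a"
  assumes pos: "lam * (x + y) ^ 4 \<le>
      b0 * y ^ 4 + 4 * b1 * x * y ^ 3 + 6 * b2 * x\<^sup>2 * y\<^sup>2 + 4 * b3 * x ^ 3 * y + b4 * x ^ 4"
    and L: "\<bar>b0\<bar> \<le> L" "\<bar>b1\<bar> \<le> L" "\<bar>b2\<bar> \<le> L" "\<bar>b3\<bar> \<le> L" "\<bar>b4\<bar> \<le> L"
    and k: "1 \<le> k" and i: "3 \<le> i" and a: "a \<le> 3 / 2" and c: "c < 1"
    and ac: "a * (real k - 1) \<le> 3 * (1 - c) * y"
    and lam: "27 / 16 * L < lam * (real k + real i - 3)"
    and E: "error_bound a c k i"
  shows "0 < b0 * (real i * (real i - 1) * (real i - 2) * (real i - 3))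
    + 4 * b1 * (real k * (real i * (real i - 1) * (real i - 2)))
    + 6 * b2 * (real k * (real k - 1) * (real i * (real i - 1)))
    + 4 * b3 * (real k * (real k - 1) * (real k - 2) * real i)
    + b4 * (real k * (real k - 1) * (real k - 2) * (real k - 3))" (is "0 < ?S")
proof -
  define E0 E1 E2 E3 E4 where "E0 = real i * (real i - 1) * (real i - 2) * (real i - 3) - y ^ 4"
    "E1 = err1 a c k i" "E2 = err2 a c k i"
    "E3 = 4 * (real k * (real k - 1) * (real k - 2) * real i - x ^ 3 * y)"
    "E4 = real k * (real k - 1) * (real k - 2) * (real k - 3) - x ^ 4"
  note E_defs = this err1_def err2_def
  define n t where "n = x + y" "t = 3 - a - c"
  note nt = this
  have "E0 \<le> 0" "E4 \<le> 0" using falling_fact4_le i k a c by (auto simp: E_defs x_def y_def)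
  moreover have "real k * (real k - 1) * (real k - 2) * real i \<le> x ^ 3 * y"
    unfolding x_def y_def using i k a c ac by (intro falling_fact3_le) (auto simp: y_def)
  then have "E3 \<le> 0" by (simp add: E_defs)
  moreover have "- (L * \<bar>e\<bar>) \<le> b * e" if "\<bar>b\<bar> \<le> L" for b e :: real
    using mult_right_mono[OF that, of "\<bar>e\<bar>"] by (simp add: abs_mult[symmetric] abs_le_iff)
  from this[OF L(1), of E0] this[OF L(2), of E1] this[OF L(3), of E2] this[OF L(4), of E3] this[OF L(5), of E4]
  have "- (L * (\<bar>E0\<bar> + \<bar>E1\<bar> + \<bar>E2\<bar> + \<bar>E3\<bar> + \<bar>E4\<bar>)) \<le> b0 * E0 + b1 * E1 + b2 * E2 + b3 * E3 + b4 * E4"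
    by (simp add: algebra_simps)
  moreover have "\<bar>E1\<bar> = 2 * max 0 E1 - E1" "\<bar>E2\<bar> = 2 * max 0 E2 - E2" by auto
  \<comment> \<open>By Vandermonde's identity and the binomial theorem the total is the falling
    factorial of \<open>k + i\<close> of length 4 minus \<open>n^4\<close>.\<close>
  moreover have "E0 + E1 + E2 + E3 + E4 = slack a c k i - 27 / 16 * n\<^sup>2 * (n + t)"
    by (simp add: E_defs slack_def nt x_def y_def power2_eq_square power3_eq_cube power4_eq_xxxx algebra_simps)
  ultimately have "- (L * (2 * max 0 E1 + 2 * max 0 E2 - (slack a c k i - 27 / 16 * n\<^sup>2 * (n + t))))
     \<le> b0 * E0 + b1 * E1 + b2 * E2 + b3 * E3 + b4 * E4" by (smt (verit))
  moreover have L0: "0 \<le> L" using L by linarith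
  have "L * (2 * max 0 E1 + 2 * max 0 E2 - (slack a c k i - 27 / 16 * n\<^sup>2 * (n + t)))
     \<le> L * (27 / 16 * n\<^sup>2 * (n + t))"
    using E L0 by (intro mult_left_mono) (auto simp: E_defs(2,3) error_bound_def)
  moreover have nt0: "0 < n" "0 < n - t" using i k a c by (auto simp: nt x_def y_def)
  have "L * (27 / 16 * n\<^sup>2 * (n + t)) < lam * n ^ 4"
  proof -
    \<comment> \<open>Here \<open>n - t = k + i - 3\<close> is the factor in the hypothesis on
      \<open>lam\<close>.\<close>
    have "L * (27 / 16 * n\<^sup>2 * (n + t)) * (n - t) = 27 / 16 * L * (n ^ 4 - n\<^sup>2 * t\<^sup>2)"
      by (simp add: power2_eq_square power4_eq_xxxx algebra_simps)
    also have "\<dots> \<le> 27 / 16 * L * n ^ 4" using L0 by (intro mult_left_mono) auto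
    also have "\<dots> < lam * (n - t) * n ^ 4"
      using lam nt0 by (intro mult_strict_right_mono) (auto simp: nt x_def y_def algebra_simps)
    finally show ?thesis using nt0 by (simp add: mult.commute mult.left_commute)
  qed
  moreover have "?S = b0 * y ^ 4 + 4 * b1 * x * y ^ 3 + 6 * b2 * x\<^sup>2 * y\<^sup>2 + 4 * b3 * x ^ 3 * y + b4 * x ^ 4
      + (b0 * E0 + b1 * E1 + b2 * E2 + b3 * E3 + b4 * E4)"
    by (simp add: E_defs x_def[symmetric] y_def[symmetric] algebra_simps)
  ultimately show ?thesis using pos by (simp add: nt)
qed

lemma quartic_form_pos:
  fixes b0 b1 b2 b3 b4 L lam :: real and i k :: nat
  assumes pos: "\<And>x y. 0 < x \<Longrightarrow> 0 < y \<Longrightarrow> lam * (x + y) ^ 4 \<le>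
      b0 * y ^ 4 + 4 * b1 * x * y ^ 3 + 6 * b2 * x\<^sup>2 * y\<^sup>2 + 4 * b3 * x ^ 3 * y + b4 * x ^ 4"
    and L: "\<bar>b0\<bar> \<le> L" "\<bar>b1\<bar> \<le> L" "\<bar>b2\<bar> \<le> L" "\<bar>b3\<bar> \<le> L" "\<bar>b4\<bar> \<le> L"
    and k: "1 \<le> k" "k \<le> i" and lam: "0 < lam" "lam \<le> L" "27 / 16 * L < lam * (real k + real i - 3)"
  shows "0 < b0 * (real i * (real i - 1) * (real i - 2) * (real i - 3))
    + 4 * b1 * (real k * (real i * (real i - 1) * (real i - 2)))
    + 6 * b2 * (real k * (real k - 1) * (real i * (real i - 1)))
    + 4 * b3 * (real k * (real k - 1) * (real k - 2) * real i)
    + b4 * (real k * (real k - 1) * (real k - 2) * (real k - 3))"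
proof -
  \<comment> \<open>As \<open>lam \<le> L\<close>, the hypothesis forces
    \<open>k + i - 3 > 27/16 > 1\<close>; integrality does the rest.\<close>
  have "5 \<le> k + i"
  proof (rule ccontr)
    assume "\<not> 5 \<le> k + i"
    then have "lam * (real k + real i - 3) \<le> lam * 1" using lam by (intro mult_left_mono) auto
    with lam show False by linarith
  qed
  then have N: "5 \<le> real k + real i" "3 \<le> i" "1 \<le> real k" "real k \<le> real i" using k by auto
  consider "real k \<le> 3 / 10 * (real k + real i)"
    | "3 / 10 * (real k + real i) \<le> real k" "real k \<le> 2 / 5 * (real k + real i)"
    | "2 / 5 * (real k + real i) \<le> real k" using k by linarith
  then show ?thesis
  proof cases
    case 1
    then have "error_bound (11 / 8) (1 / 8) k i" using N by (intro error_bound_outer) auto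
    then show ?thesis using N k lam by (intro quartic_form_pos_if_error_bound[OF pos L]) auto
  next
    case 2
    then have "error_bound (5 / 6) (1 / 3) k i" using N by (intro error_bound_middle) auto
    then show ?thesis using N k lam by (intro quartic_form_pos_if_error_bound[OF pos L]) auto
  next
    case 3
    then have "error_bound (2 / 3) (2 / 3) k i" using N by (intro error_bound_inner) auto
    then show ?thesis using N k lam by (intro quartic_form_pos_if_error_bound[OF pos L]) auto
  qed
qed

section \<open>The four degrees and the two extreme coefficients\<close>

theorem theorem1:
  fixes P :: "real poly" and d m k :: nat
  assumes "d \<in> {1, 2, 3, 4}"
    and "degree P = d"
    and "\<And>x::real. x \<ge> 0 \<Longrightarrow> poly P x > 0"
    and "real m > polya_const d * (poly_L P / poly_lambda P) - 1"
    and "k \<le> m + d"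
  shows "coeff ([:1, 1:] ^ m * P) k > 0"
proof -
  define L lam where "L = poly_L P" "lam = poly_lambda P"
  note Ll = this
  define i where "i = m + d - k"
  have ki: "k + i = m + d" using assms(5) by (simp add: i_def)
  have lam_pos: "0 < lam" and form: "\<And>x y. x \<ge> 0 \<Longrightarrow> y > 0 \<Longrightarrow>
      lam * (x + y) ^ d \<le> (\<Sum>j\<le>d. coeff P j * x ^ j * y ^ (d - j))"
    using poly_lambda_props[OF assms(3,2)] by (auto simp: Ll)
  define b where "b j = coeff P j / real (d choose j)" for j
  have b: "\<bar>b j\<bar> \<le> L" if "j \<le> d" for j
    using coeff_le_poly_L[of j P] that assms(2) by (simp add: b_def Ll)
  have a: "coeff P j = real (d choose j) * b j" if "j \<le> d" for j
    using that by (simp add: b_def)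
  have "(\<Sum>j\<le>d. coeff P j * 0 ^ j * 1 ^ (d - j)) = (\<Sum>j\<in>{0}. coeff P j * 0 ^ j * 1 ^ (d - j))"
    by (rule sum.mono_neutral_right) auto
  then have "lam \<le> b 0" using form[of 0 1] by (simp add: b_def)
  then have lam_le: "lam \<le> L" using b[of 0] by simp
  have "polya_const d * L / lam < real m + 1" using assms(4) by (simp add: Ll)
  then have lam_gt: "polya_const d * L < lam * (real m + 1)"
    using lam_pos by (simp add: divide_less_eq mult.commute)
  have a0: "0 < coeff P 0" using assms(3)[of 0] by (simp add: poly_0_coeff_0)
  have ad: "0 < coeff P d" using lead_coeff_pos[OF assms(3)] assms(2) by simp
  have sum2: "sum f {..2} = f 0 + f 1 + f 2" and sum3: "sum f {..3} = f 0 + f 1 + f 2 + f 3"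
    and sum4: "sum f {..4} = f 0 + f 1 + f 2 + f 3 + f 4" for f :: "nat \<Rightarrow> real"
    by (simp_all add: eval_nat_numeral)
  have prods: "prod f {..<2} = f 0 * f 1" "prod f {..<3} = f 0 * f 1 * f 2"
    "prod f {..<4} = f 0 * f 1 * f 2 * f 3" for f :: "nat \<Rightarrow> real"
    by (simp_all add: eval_nat_numeral mult.assoc)
  have choose3: "3 choose 2 = 3" and choose4: "4 choose 2 = 6" "4 choose 3 = 4"
    by (simp_all add: eval_nat_numeral)
  have key: "0 < (\<Sum>j\<le>d. coeff P j * ((\<Prod>l<j. real k - real l) * (\<Prod>l<d - j. real i - real l)))"
    if "1 \<le> k" "1 \<le> i"
  proof -
    consider "d = 1" | "d = 2" | "d = 3" | "d = 4" using assms(1) by auto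
    then show ?thesis
    proof cases
      case 1
      \<comment> \<open>In degree one the falling factorials are powers, so there is no error and
        the constant is 0.\<close>
      then show ?thesis using a0 ad that by (simp add: add_pos_pos)
    next
      case 2
      have a2: "coeff P 0 = b 0" "coeff P (Suc 0) = 2 * b 1" "coeff P 2 = b 2"
        using a[of 0] a[of 1] a[of 2] 2 by auto
      have "0 < b 0 * (real i * (real i - 1)) + 2 * b 1 * (real k * real i) + b 2 * (real k * (real k - 1))"
      proof (rule quadratic_form_pos)
        show "lam * (real k + real i)\<^sup>2 \<le> b 0 * (real i)\<^sup>2 + 2 * b 1 * real k * real i + b 2 * (real k)\<^sup>2"
          using form[of "real k" "real i"] that by (simp add: 2 sum2 a2)
        have "real k + real i = real m + 2" using ki 2 by linarith
        then show "L < lam * (real k + real i)"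
          using lam_gt lam_pos 2 by (simp add: polya_const_def algebra_simps)
      qed (use b[of 0] b[of 2] 2 that in auto)
      then show ?thesis by (simp add: 2 sum2 prods a2 algebra_simps)
    next
      case 3
      have a3: "coeff P 0 = b 0" "coeff P (Suc 0) = 3 * b 1" "coeff P 2 = 3 * b 2" "coeff P 3 = b 3"
        using a[of 0] a[of 1] a[of 2] a[of 3] 3 by (auto simp: choose3)
      have form3: "lam * (x + y) ^ 3 \<le> b 0 * y ^ 3 + 3 * b 1 * x * y\<^sup>2 + 3 * b 2 * x\<^sup>2 * y + b 3 * x ^ 3"
        if "0 < x" "0 < y" for x y
        using form[of x y] that by (simp add: 3 sum3 a3)
      have b3: "\<bar>b 0\<bar> \<le> L" "\<bar>b 1\<bar> \<le> L" "\<bar>b 2\<bar> \<le> L" "\<bar>b 3\<bar> \<le> L" using b 3 by auto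
      have kir: "real k + real i = real m + 3" using ki 3 by linarith
      then have lam3: "3 / 2 * L < lam * (real k + real i - 2)" "3 / 2 * L < lam * (real i + real k - 2)"
        using lam_gt 3 by (auto simp: polya_const_def algebra_simps)
      show ?thesis
      proof (cases "k \<le> i")
        case True
        then have "1 < real i" "1 \<le> real k" using that kir by auto
        then show ?thesis
          using cubic_form_pos[OF form3 b3 _ _ _ lam3(1)] True
          by (simp add: 3 sum3 prods a3 algebra_simps)
      next
        case False
        \<comment> \<open>Reversing the coefficients exchanges \<open>k\<close> and
          \<open>i\<close>, which restores the order required by the cubic bound.\<close>
        have rev: "lam * (x + y) ^ 3 \<le> b 3 * y ^ 3 + 3 * b 2 * x * y\<^sup>2 + 3 * b 1 * x\<^sup>2 * y + b 0 * x ^ 3"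
          if "0 < x" "0 < y" for x y
          using form3[of y x] that by (simp add: algebra_simps)
        have "1 < real k" "1 \<le> real i" using that False by auto
        then show ?thesis
          using cubic_form_pos[OF rev b3(4,3,2,1) _ _ _ lam3(2)] False
          by (simp add: 3 sum3 prods a3 algebra_simps)
      qed
    next
      case 4
      have a4: "coeff P 0 = b 0" "coeff P (Suc 0) = 4 * b 1" "coeff P 2 = 6 * b 2" "coeff P 3 = 4 * b 3"
          "coeff P 4 = b 4"
        using a[of 0] a[of 1] a[of 2] a[of 3] a[of 4] 4 by (auto simp: choose4)
      have form4: "lam * (x + y) ^ 4 \<le>
          b 0 * y ^ 4 + 4 * b 1 * x * y ^ 3 + 6 * b 2 * x\<^sup>2 * y\<^sup>2 + 4 * b 3 * x ^ 3 * y + b 4 * x ^ 4"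
        if "0 < x" "0 < y" for x y
        using form[of x y] that by (simp add: 4 sum4 a4)
      have b4: "\<bar>b 0\<bar> \<le> L" "\<bar>b 1\<bar> \<le> L" "\<bar>b 2\<bar> \<le> L" "\<bar>b 3\<bar> \<le> L" "\<bar>b 4\<bar> \<le> L" using b 4 by auto
      have "27 / 16 * L \<le> polya_const d * L"
        using lam_pos lam_le 4 by (intro mult_right_mono) (auto simp: polya_const_def)
      moreover have "real k + real i = real m + 4" using ki 4 by linarith
      ultimately have lam4: "27 / 16 * L < lam * (real k + real i - 3)" "27 / 16 * L < lam * (real i + real k - 3)"
        using lam_gt by (auto simp: algebra_simps)
      show ?thesis
      proof (cases "k \<le> i")
        case True
        show ?thesis
          using quartic_form_pos[OF form4 b4 that(1) True lam_pos lam_le lam4(1)]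
          by (simp add: 4 sum4 prods a4 algebra_simps)
      next
        case False
        then have "i \<le> k" by simp
        have rev: "lam * (x + y) ^ 4 \<le>
            b 4 * y ^ 4 + 4 * b 3 * x * y ^ 3 + 6 * b 2 * x\<^sup>2 * y\<^sup>2 + 4 * b 1 * x ^ 3 * y + b 0 * x ^ 4"
          if "0 < x" "0 < y" for x y
          using form4[of y x] that by (simp add: algebra_simps)
        show ?thesis
          using quartic_form_pos[OF rev b4(5,4,3,2,1) that(2) \<open>i \<le> k\<close> lam_pos lam_le lam4(2)]
          by (simp add: 4 sum4 prods a4 algebra_simps)
      qed
    qed
  qed
  \<comment> \<open>In the first two cases the coefficient is the constant or the leading
    coefficient of \<open>P\<close>.\<close>
  consider "k = 0" | "i = 0" | "1 \<le> k" "1 \<le> i" by linarith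
  then show ?thesis
  proof cases
    case 1
    then show ?thesis using a0 by (simp add: coeff_mult_0 coeff_0_power)
  next
    case 2
    have "degree ([:1, 1:] ^ m :: real poly) = m" by (rule degree_linear_power)
    then show ?thesis
      using coeff_mult_degree_sum[of "[:1, 1:] ^ m" P] assms(2) ki 2 ad coeff_linear_power[of "1 :: real" m]
      by simp
  next
    case 3
    then have "0 < coeff ([:1, 1:] ^ m * P) k * (fact k * fact i)"
      using key coeff_linear_power_mult[OF assms(2) ki] by (simp add: mult.assoc)
    then show ?thesis by (rule zero_less_mult_pos2) simp
  qed
qed

end
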